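(* Assume that $\mathcal{SP}(\mathcal{A}^*,\mathbb{C})=\mathcal{P}(\mathcal{A}^*,\mathbb{C})$ holds for every alphabet $\mathcal{A}$, where $\mathcal{A}^*$ is the free monoid of words over $\mathcal{A}$ under concatenation. Then $\mathcal{SP}(S,\mathbb{C})=\mathcal{P}(S,\mathbb{C})$ for every monoid $S$.
   Context: Let $(S,\cdot,e)$ be a monoid and $(G,+,0)$ a commutative group. For $s\in S$ define operators on functions $f:S\to G$ by $L_s(f)(t)=f(st)-f(t)$ and $R_s(f)(t)=f(ts)-f(t)$. Polynomial maps are defined inductively: the maps of functional degree $\le 0$ are exactly the constant functions; for $n\ge 1$, $f:S\to G$ is a polynomial map of functional degree $\le n$ if and only if for each $s\in S$ both $R_s(f)$ and $L_s(f)$ are polynomial maps of functional degree $\le n-1$. $\mathcal{P}_n(S,G)$ is the set of polynomial maps of functional degree $\le n$ and $\mathcal{P}(S,G)=\bigcup_{n\ge0}\mathcal{P}_n(S,G)$. A map $f:S\to G$ is a semipolynomial map of functional degree $\le m$ if for every $h\in S$ and every choice of $D_1,\dots,D_{m+1}\in\{R_h,L_h\}$ one has $D_1D_2\cdots D_{m+1}f(x)=0$ for all $x\in S$. The set of these is $\mathcal{SP}_m(S,G)$, and $\mathcal{SP}(S,G)=\bigcup_{m\ge0}\mathcal{SP}_m(S,G)$. Here $G=(\mathbb{C},+)$. *)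

theory Defs
  imports Complex_Main "HOL-Library.FuncSet" "HOL-Algebra.Group"
begin

text \<open>
  A map from a monoid \<open>S\<close> to the additive group of a type \<open>'g\<close> is an extensional function on
  \<open>carrier S\<close>, so that equality of maps is equality on the carrier.
\<close>

abbreviation maps_on :: "('a, 'b) monoid_scheme \<Rightarrow> ('a \<Rightarrow> 'g::ab_group_add) set"
  where "maps_on S \<equiv> carrier S \<rightarrow>\<^sub>E UNIV"

definition left_diff ::
    "('a, 'b) monoid_scheme \<Rightarrow> 'a \<Rightarrow> ('a \<Rightarrow> 'g::ab_group_add) \<Rightarrow> 'a \<Rightarrow> 'g"
  where "left_diff S s f = (\<lambda>t\<in>carrier S. f (s \<otimes>\<^bsub>S\<^esub> t) - f t)"

definition right_diff ::
    "('a, 'b) monoid_scheme \<Rightarrow> 'a \<Rightarrow> ('a \<Rightarrow> 'g::ab_group_add) \<Rightarrow> 'a \<Rightarrow> 'g"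
  where "right_diff S s f = (\<lambda>t\<in>carrier S. f (t \<otimes>\<^bsub>S\<^esub> s) - f t)"

primrec polynomial_maps_deg ::
    "('a, 'b) monoid_scheme \<Rightarrow> nat \<Rightarrow> ('a \<Rightarrow> 'g::ab_group_add) set"
  where
    "polynomial_maps_deg S 0 = {f \<in> maps_on S. \<exists>c. \<forall>x\<in>carrier S. f x = c}"
  | "polynomial_maps_deg S (Suc n) =
       {f \<in> maps_on S. \<forall>s\<in>carrier S.
          right_diff S s f \<in> polynomial_maps_deg S n \<and> left_diff S s f \<in> polynomial_maps_deg S n}"

definition polynomial_maps :: "('a, 'b) monoid_scheme \<Rightarrow> ('a \<Rightarrow> 'g::ab_group_add) set"
  where "polynomial_maps S = (\<Union>n. polynomial_maps_deg S n)"

text \<open>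
  The list \<open>[D\<^sub>1, \<dots>, D\<^sub>k]\<close> below stands for the composite operator \<open>D\<^sub>1 \<cdots> D\<^sub>k\<close>; one and the
  same \<open>h\<close> is used in all factors.
\<close>

definition semipolynomial_maps_deg ::
    "('a, 'b) monoid_scheme \<Rightarrow> nat \<Rightarrow> ('a \<Rightarrow> 'g::ab_group_add) set"
  where "semipolynomial_maps_deg S m =
    {f \<in> maps_on S. \<forall>h\<in>carrier S. \<forall>Ds.
       length Ds = m + 1 \<and> set Ds \<subseteq> {right_diff S h, left_diff S h} \<longrightarrow>
       (\<forall>x\<in>carrier S. foldr (\<lambda>D g. D g) Ds f x = 0)}"

definition semipolynomial_maps :: "('a, 'b) monoid_scheme \<Rightarrow> ('a \<Rightarrow> 'g::ab_group_add) set"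
  where "semipolynomial_maps S = (\<Union>m. semipolynomial_maps_deg S m)"

definition free_monoid :: "'a set \<Rightarrow> 'a list monoid"
  where "free_monoid A = \<lparr>carrier = lists A, mult = (@), one = []\<rparr>"

lemma monoid_free_monoid: "monoid (free_monoid A)"
  by unfold_locales (auto simp: free_monoid_def)

end

(* Every monoid S is the image of the free monoid over its carrier under the evaluation
   homomorphism. Pulling functions back along a surjective homomorphism commutes with the
   difference operators, so it preserves and reflects both kinds of polynomial maps. *)
theory Submission
  imports Defs
begin

text \<open>Since \<open>p (s t) = p s p t\<close> on the carrier and both sides are
  \<open>undefined\<close> off it, this is an equation of extensional functions, so it can be
  rewritten with under further operators.\<close>

lemma left_diff_compose:
  assumes "monoid T" "p \<in> hom T S" "s \<in> carrier T"
  shows "left_diff T s (compose (carrier T) f p) = compose (carrier T) (left_diff S (p s) f) p"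
  using assms
  by (auto simp: left_diff_def compose_def fun_eq_iff hom_in_carrier hom_mult monoid.m_closed)

lemma right_diff_compose:
  assumes "monoid T" "p \<in> hom T S" "s \<in> carrier T"
  shows "right_diff T s (compose (carrier T) f p) = compose (carrier T) (right_diff S (p s) f) p"
  using assms
  by (auto simp: right_diff_def compose_def fun_eq_iff hom_in_carrier hom_mult monoid.m_closed)

text \<open>Induction on the degree. As \<open>p\<close> is onto, quantifying over
  \<open>p s\<close> with \<open>s\<close> in \<open>T\<close> exhausts \<open>S\<close>; this gives
  the reflecting direction, both for constancy and for the shifts.\<close>

lemma polynomial_maps_deg_compose_iff:
  fixes f :: "'a \<Rightarrow> 'g::ab_group_add"
  assumes T: "monoid T" and p: "p \<in> epi T S" and f: "f \<in> maps_on S"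
  shows "compose (carrier T) f p \<in> polynomial_maps_deg T n \<longleftrightarrow> f \<in> polynomial_maps_deg S n"
  using f
proof (induction n arbitrary: f)
  case 0
  have "carrier S = p ` carrier T"
    using p by (simp add: epi_def)
  then show ?case
    using 0 by (auto simp: compose_def)
next
  case (Suc n)
  have hom: "p \<in> hom T S" and S: "carrier S = p ` carrier T"
    using p by (auto simp: epi_def)
  have "left_diff T s (compose (carrier T) f p) \<in> polynomial_maps_deg T n \<longleftrightarrow>
      left_diff S (p s) f \<in> polynomial_maps_deg S n" if "s \<in> carrier T" for s
    unfolding left_diff_compose[OF T hom that] by (rule Suc.IH) (auto simp: left_diff_def)
  moreover have "right_diff T s (compose (carrier T) f p) \<in> polynomial_maps_deg T n \<longleftrightarrow>
      right_diff S (p s) f \<in> polynomial_maps_deg S n" if "s \<in> carrier T" for s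
    unfolding right_diff_compose[OF T hom that] by (rule Suc.IH) (auto simp: right_diff_def)
  moreover have "compose (carrier T) f p \<in> maps_on T"
    by (auto simp: compose_def)
  ultimately show ?case
    using Suc.prems by (simp add: S)
qed

text \<open>Booleans record the choice of side independently of the monoid, so one list describes a
  composite operator over \<open>T\<close> and over \<open>S\<close>, although the operators have
  different types.\<close>

abbreviation side_diff ::
    "('a, 'b) monoid_scheme \<Rightarrow> 'a \<Rightarrow> bool \<Rightarrow> ('a \<Rightarrow> 'g::ab_group_add) \<Rightarrow> 'a \<Rightarrow> 'g"
  where "side_diff S h b \<equiv> if b then right_diff S h else left_diff S h"

lemma semipolynomial_maps_deg_iff:
  "f \<in> semipolynomial_maps_deg S m \<longleftrightarrow> f \<in> maps_on S \<and>
    (\<forall>h\<in>carrier S. \<forall>bs. length bs = m + 1 \<longrightarrow>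
      (\<forall>x\<in>carrier S. foldr (side_diff S h) bs f x = 0))"
proof -
  have *: "(\<forall>Ds. length Ds = k \<and> set Ds \<subseteq> {right_diff S h, left_diff S h} \<longrightarrow> P Ds) \<longleftrightarrow>
      (\<forall>bs. length bs = k \<longrightarrow> P (map (side_diff S h) bs))" for k h P
  proof -
    have "{right_diff S h, left_diff S h} = range (side_diff S h)"
      by (auto simp: UNIV_bool)
    \<comment> \<open>If the two operators coincide, several Boolean lists encode the same
      \<open>Ds\<close>; only the existence of one matters.\<close>
    then have "set Ds \<subseteq> {right_diff S h, left_diff S h} \<longleftrightarrow> (\<exists>bs. Ds = map (side_diff S h) bs)" for Ds
      by (simp only: ex_map_conv) auto
    then show ?thesis
      by (metis length_map)
  qed
  show ?thesis
    by (simp add: semipolynomial_maps_deg_def * foldr_map comp_def)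
qed

lemma foldr_side_diff_compose:
  assumes "monoid T" "p \<in> hom T S" "h \<in> carrier T"
  shows "foldr (side_diff T h) bs (compose (carrier T) f p) =
    compose (carrier T) (foldr (side_diff S (p h)) bs f) p"
  by (induction bs) (simp_all add: left_diff_compose[OF assms] right_diff_compose[OF assms])

lemma semipolynomial_maps_deg_compose_iff:
  assumes T: "monoid T" and p: "p \<in> epi T S" and f: "f \<in> maps_on S"
  shows "compose (carrier T) f p \<in> semipolynomial_maps_deg T m \<longleftrightarrow>
    f \<in> semipolynomial_maps_deg S m"
proof -
  have hom: "p \<in> hom T S" and S: "carrier S = p ` carrier T"
    using p by (auto simp: epi_def)
  have "compose (carrier T) f p \<in> maps_on T"
    by (auto simp: compose_def)
  then show ?thesis
    using f unfolding semipolynomial_maps_deg_iff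
    \<comment> \<open>\<open>ball_cong\<close> supplies the carrier membership under which the
      operators commute with the pullback and \<open>compose_eq\<close> evaluates it.\<close>
    by (simp add: foldr_side_diff_compose[OF T hom] S compose_eq cong: ball_cong)
qed

text \<open>Associativity makes the product of letters multiplicative, and the one-letter word
  \<open>[x]\<close> evaluates to \<open>x\<close>.\<close>

lemma foldr_mult_epi:
  assumes "monoid S"
  shows "(\<lambda>w. foldr (mult S) w \<one>\<^bsub>S\<^esub>) \<in> epi (free_monoid (carrier S)) S"
proof -
  interpret monoid S by fact
  have closed: "foldr (mult S) w \<one>\<^bsub>S\<^esub> \<in> carrier S" if "w \<in> lists (carrier S)" for w
    using that by (induction w) auto
  have "foldr (mult S) (v @ w) \<one>\<^bsub>S\<^esub> = foldr (mult S) v \<one>\<^bsub>S\<^esub> \<otimes>\<^bsub>S\<^esub> foldr (mult S) w \<one>\<^bsub>S\<^esub>"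
    if "v \<in> lists (carrier S)" "w \<in> lists (carrier S)" for v w
    \<comment> \<open>Reversing \<open>foldr_append\<close> keeps the product of
      \<open>v @ w\<close> a single fold starting at the unit, the form the induction hypothesis
      has.\<close>
    using that by (induction v) (auto simp: closed m_assoc simp flip: foldr_append)
  moreover have "x \<in> (\<lambda>w. foldr (mult S) w \<one>\<^bsub>S\<^esub>) ` lists (carrier S)" if "x \<in> carrier S" for x
    using that by (intro image_eqI[of _ _ "[x]"]) auto
  ultimately show ?thesis
    by (auto intro!: closed simp: epi_def hom_def free_monoid_def simp del: foldr_append)
qed

theorem theorem3p3:
  assumes "\<forall>A :: 'a set.
    (semipolynomial_maps (free_monoid A) :: ('a list \<Rightarrow> complex) set) = polynomial_maps (free_monoid A)"
  shows "\<forall>S :: ('a, 'b) monoid_scheme. monoid S \<longrightarrow>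
    (semipolynomial_maps S :: ('a \<Rightarrow> complex) set) = polynomial_maps S"
proof (intro allI impI)
  fix S :: "('a, 'b) monoid_scheme"
  assume S: "monoid S"
  \<comment> \<open>The elements of \<open>S\<close> serve as letters, so this alphabet is a set
    over the type for which the hypothesis is stated.\<close>
  let ?T = "free_monoid (carrier S)"
  let ?p = "\<lambda>w. foldr (mult S) w \<one>\<^bsub>S\<^esub>"
  note T = monoid_free_monoid[of "carrier S"] and p = foldr_mult_epi[OF S]
  have eq: "f \<in> semipolynomial_maps S \<longleftrightarrow> f \<in> polynomial_maps S"
    if f: "f \<in> maps_on S" for f :: "'a \<Rightarrow> complex"
  proof -
    \<comment> \<open>The pullback equivalences hold degree by degree, hence for the unions over all
      degrees.\<close>
    have "f \<in> semipolynomial_maps S \<longleftrightarrow> compose (carrier ?T) f ?p \<in> semipolynomial_maps ?T"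
      by (simp add: semipolynomial_maps_def semipolynomial_maps_deg_compose_iff[OF T p f])
    also have "\<dots> \<longleftrightarrow> compose (carrier ?T) f ?p \<in> polynomial_maps ?T"
      using assms by simp
    also have "\<dots> \<longleftrightarrow> f \<in> polynomial_maps S"
      by (simp add: polynomial_maps_def polynomial_maps_deg_compose_iff[OF T p f])
    finally show ?thesis .
  qed
  \<comment> \<open>\<open>eq\<close> compares extensional maps only; set equality follows once both
    sets are known to contain no others.\<close>
  have "f \<in> maps_on S" if "f \<in> polynomial_maps_deg S n" for f :: "'a \<Rightarrow> complex" and n
    using that by (cases n) simp_all
  then have "(polynomial_maps S :: ('a \<Rightarrow> complex) set) \<subseteq> maps_on S"
    unfolding polynomial_maps_def by blast
  moreover have "(semipolynomial_maps S :: ('a \<Rightarrow> complex) set) \<subseteq> maps_on S"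
    unfolding semipolynomial_maps_def semipolynomial_maps_deg_def by blast
  ultimately show "(semipolynomial_maps S :: ('a \<Rightarrow> complex) set) = polynomial_maps S"
    using eq by blast
qed

end
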